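(* Let $T=\mathrm{Th}(M)$ and $p(x,y)=\{R_n(x,y)\mid n<\omega\}$, where $M$ is the structure described in the context. Let $N\models T$ be $\aleph_1$-saturated. Then for any $m<\omega$ and any distinct $\alpha_0,\ldots,\alpha_m\in Q^N$, the intersection $\bigcap_{i\le m}p(N,\alpha_i)$ is different from any sub-intersection of size $m$, i.e. from $\bigcap_{i\in v}p(N,\alpha_i)$ for every $v\subseteq\{0,\ldots,m\}$ with $|v|=m$.
   Context: Let $S=\{u\subseteq\omega\mid |u|<\omega\}$ and $V=\{f:S\to\{0,1\}\mid |\mathrm{supp}(f)|<\infty\}$, where $\mathrm{supp}(f)=\{x\in S\mid f(x)\ne 0\}$; $V$ is a group as a vector space over $\mathbb{F}_2=\mathbb{Z}/2\mathbb{Z}$. For $n,m<\omega$ define $G_n=\{f\in V\mid u\in\mathrm{supp}(f)\Rightarrow |u|=n\}$, $G_\omega=\prod_{n<\omega}G_n$ (full direct product), $G_{n,m}=\{f\in V\mid u\in\mathrm{supp}(f)\Rightarrow |u|=n \text{ and } m\in u\}$ (so $G_{0,m}=0$), $H_{n,m}=\{\eta\in G_\omega\mid \eta(n)\in G_{n,m}\}$. The language is $L=\{P,Q\}\cup\{R_n\mid n<\omega\}\cup\{0,+\}$ with $P,Q$ unary predicates and each $R_n$ a binary relation. $M$ is the $L$-structure whose universe is the disjoint union of $P^M=G_\omega$ and $Q^M=\omega$, with $0,+$ interpreted on $P^M$ as the group structure of $G_\omega$ (and, say, $x+y=0$ if $x,y$ are not both in $P^M$), and $R_n^M=\{(\eta,m)\mid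 \eta\in H_{n,m}\}$. For $N\models T$ and $\alpha\in Q^N$, $p(N,\alpha)=\{x\in N\mid N\models R_n(x,\alpha)\text{ for all }n<\omega\}$, a subgroup of $P^N$. The empty intersection is $P^N$. *)

theory Defs
  imports "HOL-Library.FSet" "HOL-Library.Poly_Mapping" "HOL-Library.Z2" "HOL-Library.Countable_Set"
begin

section \<open>First-order logic over the language \<open>{P, Q} \<union> {R\<^sub>n | n < \<omega>} \<union> {0, +}\<close>\<close>

datatype tm = Var nat | Zero | Plus tm tm

datatype fm =
    Equal tm tm
  | FP tm
  | FQ tm
  | FR nat tm tm
  | Neg fm
  | Conj fm fm
  | Ex nat fm

primrec vars_tm :: "tm \<Rightarrow> nat set" where
  "vars_tm (Var i) = {i}"
| "vars_tm Zero = {}"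
| "vars_tm (Plus s t) = vars_tm s \<union> vars_tm t"

primrec fv :: "fm \<Rightarrow> nat set" where
  "fv (Equal s t) = vars_tm s \<union> vars_tm t"
| "fv (FP t) = vars_tm t"
| "fv (FQ t) = vars_tm t"
| "fv (FR n s t) = vars_tm s \<union> vars_tm t"
| "fv (Neg \<phi>) = fv \<phi>"
| "fv (Conj \<phi> \<psi>) = fv \<phi> \<union> fv \<psi>"
| "fv (Ex i \<phi>) = fv \<phi> - {i}"

definition sentence :: "fm \<Rightarrow> bool" where
  "sentence \<phi> \<longleftrightarrow> fv \<phi> = {}"

record 'a L_struct =
  univ :: "'a set"
  PI :: "'a set"
  QI :: "'a set"
  RI :: "nat \<Rightarrow> ('a \<times> 'a) set"
  zeroI :: 'a
  addI :: "'a \<Rightarrow> 'a \<Rightarrow> 'a"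

definition L_structure :: "'a L_struct \<Rightarrow> bool" where
  "L_structure N \<longleftrightarrow>
     PI N \<subseteq> univ N \<and> QI N \<subseteq> univ N \<and> (\<forall>n. RI N n \<subseteq> univ N \<times> univ N) \<and>
     zeroI N \<in> univ N \<and> (\<forall>x\<in>univ N. \<forall>y\<in>univ N. addI N x y \<in> univ N)"

primrec eval_tm :: "'a L_struct \<Rightarrow> (nat \<Rightarrow> 'a) \<Rightarrow> tm \<Rightarrow> 'a" where
  "eval_tm N e (Var i) = e i"
| "eval_tm N e Zero = zeroI N"
| "eval_tm N e (Plus s t) = addI N (eval_tm N e s) (eval_tm N e t)"

primrec sat :: "'a L_struct \<Rightarrow> (nat \<Rightarrow> 'a) \<Rightarrow> fm \<Rightarrow> bool" where
  "sat N e (Equal s t) \<longleftrightarrow> eval_tm N e s = eval_tm N e t"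
| "sat N e (FP t) \<longleftrightarrow> eval_tm N e t \<in> PI N"
| "sat N e (FQ t) \<longleftrightarrow> eval_tm N e t \<in> QI N"
| "sat N e (FR n s t) \<longleftrightarrow> (eval_tm N e s, eval_tm N e t) \<in> RI N n"
| "sat N e (Neg \<phi>) \<longleftrightarrow> \<not> sat N e \<phi>"
| "sat N e (Conj \<phi> \<psi>) \<longleftrightarrow> sat N e \<phi> \<and> sat N e \<psi>"
| "sat N e (Ex i \<phi>) \<longleftrightarrow> (\<exists>a\<in>univ N. sat N (e(i := a)) \<phi>)"

definition true_in :: "'a L_struct \<Rightarrow> fm \<Rightarrow> bool" where
  "true_in N \<phi> \<longleftrightarrow> (\<forall>e. range e \<subseteq> univ N \<longrightarrow> sat N e \<phi>)"

definition Th :: "'a L_struct \<Rightarrow> fm set" where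
  "Th N = {\<phi>. sentence \<phi> \<and> true_in N \<phi>}"

definition model_of :: "'a L_struct \<Rightarrow> fm set \<Rightarrow> bool" where
  "model_of N T \<longleftrightarrow> L_structure N \<and> (\<forall>\<phi>\<in>T. true_in N \<phi>)"


section \<open>Types and saturation\<close>

text \<open>
  A formula \<open>\<phi>(x, a\<^sub>1, \<dots>, a\<^sub>k)\<close> with parameters in \<open>A\<close> is represented by a pair \<open>(\<phi>, e)\<close>: the
  variable \<open>x\<close> is variable \<open>0\<close>, and \<open>e\<close> assigns the parameters to the other free variables of \<open>\<phi>\<close>.
  The values of \<open>e\<close> elsewhere are irrelevant.
\<close>

definition formulas_over :: "'a set \<Rightarrow> (fm \<times> (nat \<Rightarrow> 'a)) set" where
  "formulas_over A = {(\<phi>, e). \<forall>i \<in> fv \<phi> - {0}. e i \<in> A}"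

definition realizes :: "'a L_struct \<Rightarrow> 'a \<Rightarrow> (fm \<times> (nat \<Rightarrow> 'a)) set \<Rightarrow> bool" where
  "realizes N a q \<longleftrightarrow> a \<in> univ N \<and> (\<forall>(\<phi>, e) \<in> q. sat N (e(0 := a)) \<phi>)"

text \<open>Elements of \<open>S\<^sub>1(A)\<close>: sets of formulas over \<open>A\<close> that are finitely satisfiable in \<open>N\<close> and complete.\<close>

definition complete_type :: "'a L_struct \<Rightarrow> 'a set \<Rightarrow> (fm \<times> (nat \<Rightarrow> 'a)) set \<Rightarrow> bool" where
  "complete_type N A q \<longleftrightarrow>
     q \<subseteq> formulas_over A \<and>
     (\<forall>F. finite F \<and> F \<subseteq> q \<longrightarrow> (\<exists>a. realizes N a F)) \<and>
     (\<forall>(\<phi>, e) \<in> formulas_over A. (\<phi>, e) \<in> q \<or> (Neg \<phi>, e) \<in> q)"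

text \<open>Parameter sets of cardinality less than \<open>\<aleph>\<^sub>1\<close> are exactly the countable ones.\<close>

definition aleph1_saturated :: "'a L_struct \<Rightarrow> bool" where
  "aleph1_saturated N \<longleftrightarrow>
     (\<forall>A q. A \<subseteq> univ N \<and> countable A \<and> complete_type N A q \<longrightarrow> (\<exists>a. realizes N a q))"


section \<open>The structure \<open>M\<close>\<close>

text \<open>
  \<open>S\<close> is the type \<open>nat fset\<close>, and \<open>V\<close> is the group of finitely supported functions from \<open>S\<close> to the
  two-element field \<open>bit\<close>; the support of \<open>f\<close> is \<open>Poly_Mapping.keys f\<close>.
\<close>

type_synonym V = "nat fset \<Rightarrow>\<^sub>0 bit"

definition G :: "nat \<Rightarrow> V set" where
  "G n = {f. \<forall>u \<in> Poly_Mapping.keys f. fcard u = n}"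

definition G_omega :: "(nat \<Rightarrow> V) set" where
  "G_omega = {\<eta>. \<forall>n. \<eta> n \<in> G n}"

definition G2 :: "nat \<Rightarrow> nat \<Rightarrow> V set" where
  "G2 n m = {f. \<forall>u \<in> Poly_Mapping.keys f. fcard u = n \<and> m |\<in>| u}"

definition H :: "nat \<Rightarrow> nat \<Rightarrow> (nat \<Rightarrow> V) set" where
  "H n m = {\<eta> \<in> G_omega. \<eta> n \<in> G2 n m}"

fun add_M :: "(nat \<Rightarrow> V) + nat \<Rightarrow> (nat \<Rightarrow> V) + nat \<Rightarrow> (nat \<Rightarrow> V) + nat" where
  "add_M (Inl \<eta>) (Inl \<xi>) = Inl (\<lambda>n. \<eta> n + \<xi> n)"
| "add_M _ _ = Inl (\<lambda>n. 0)"

definition M :: "((nat \<Rightarrow> V) + nat) L_struct" where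
  "M = \<lparr> univ = Inl ` G_omega \<union> range Inr,
         PI = Inl ` G_omega,
         QI = range Inr,
         RI = (\<lambda>n. {(Inl \<eta>, Inr m) | \<eta> m. \<eta> \<in> H n m}),
         zeroI = Inl (\<lambda>n. 0),
         addI = add_M \<rparr>"

lemma L_structure_M: "L_structure M"
proof -
  have add: "(\<lambda>n. \<eta> n + \<xi> n) \<in> G_omega" if "\<eta> \<in> G_omega" "\<xi> \<in> G_omega" for \<eta> \<xi>
    using that Poly_Mapping.keys_add by (fastforce simp: G_omega_def G_def)
  have zero: "(\<lambda>n. 0) \<in> G_omega"
    by (simp add: G_omega_def G_def)
  show ?thesis
    using add zero by (auto simp: L_structure_def M_def H_def)
qed


section \<open>The partial type \<open>p(x, y)\<close> and its intersections\<close>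

text \<open>Here \<open>x\<close> is variable \<open>0\<close> and \<open>y\<close> is variable \<open>1\<close>.\<close>

definition p :: "fm set" where
  "p = {FR n (Var 0) (Var 1) | n. True}"

definition p_set :: "'a L_struct \<Rightarrow> 'a \<Rightarrow> 'a set" where
  "p_set N \<alpha> = {x \<in> univ N. \<forall>\<phi> \<in> p. sat N (\<lambda>i. if i = 0 then x else \<alpha>) \<phi>}"

text \<open>The empty intersection is \<open>P\<^sup>N\<close>, not the set of all elements of the type.\<close>

definition p_Inter :: "'a L_struct \<Rightarrow> (nat \<Rightarrow> 'a) \<Rightarrow> nat set \<Rightarrow> 'a set" where
  "p_Inter N \<alpha> v = (if v = {} then PI N else (\<Inter>i\<in>v. p_set N (\<alpha> i)))"

end

theory Submission
  imports Defs
begin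

text \<open>
  Let \<open>v = {..m} - {j}\<close>. In \<open>M\<close> the two intersections are separated by one vector: for distinct
  natural numbers \<open>a\<^sub>0, \<dots>, a\<^sub>m\<close>, let \<open>\<eta>\<close> vanish at every level except \<open>m\<close>, and let \<open>\<eta>(m)\<close> be the
  indicator function of the \<open>m\<close>-element set \<open>u = {a\<^sub>i | i \<in> v}\<close>. Since \<open>u\<close> contains all \<open>a\<^sub>i\<close> with
  \<open>i \<in> v\<close> but not \<open>a\<^sub>j\<close>, the vector satisfies \<open>R\<^sub>n(\<eta>, a\<^sub>i)\<close> for all \<open>n\<close> and all \<open>i \<in> v\<close>, whereas
  \<open>R\<^sub>m(\<eta>, a\<^sub>j)\<close> fails (lemma \<open>separating_vector\<close>).

  So \<open>M\<close> realizes the set of formulas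
  \<open>{P(x)} \<union> {R\<^sub>n(x, y\<^sub>i) | n < \<omega>, i \<in> v} \<union> {\<not> R\<^sub>m(x, y\<^sub>j)}\<close>
  for every choice of distinct parameters in \<open>Q\<close>. Realizability of one finite part of this set,
  for all such parameters, is a single first-order sentence, hence passes from \<open>M\<close> to \<open>N\<close>; and
  saturation of \<open>N\<close> turns finite satisfiability into realizability. This transfer principle is
  lemma \<open>realizable_transfer\<close>; it holds for an arbitrary structure in place of \<open>M\<close> and an
  arbitrary set of formulas.
  The realization found in \<open>N\<close> lies in the intersection over \<open>v\<close> but not in \<open>p(N, \<alpha>\<^sub>j)\<close>. For
  \<open>m = 0\<close> the formula \<open>P(x)\<close> places it in the empty intersection.
\<close>

section \<open>Transfer of formulas with free variables\<close>

abbreviation Forall :: "nat \<Rightarrow> fm \<Rightarrow> fm" where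
  "Forall i \<phi> \<equiv> Neg (Ex i (Neg \<phi>))"

text \<open>
  Truth of a formula in a structure already quantifies over all assignments, so prefixing universal
  quantifiers changes nothing. This reduces formulas to sentences without having to know that
  satisfaction depends only on the free variables.
\<close>

lemma true_in_All:
  fixes N :: "'a L_struct"
  shows "true_in N (Forall i \<phi>) \<longleftrightarrow> true_in N \<phi>"
proof
  assume L: "true_in N (Forall i \<phi>)"
  show "true_in N \<phi>"
    unfolding true_in_def
  proof (intro allI impI)
    fix e :: "nat \<Rightarrow> 'a" assume e: "range e \<subseteq> univ N"
    then have "e i \<in> univ N" by blast
    with L e have "sat N (e(i := e i)) \<phi>"
      unfolding true_in_def by (metis sat.simps(5,7))
    then show "sat N e \<phi>" by simp
  qed
next
  assume R: "true_in N \<phi>"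
  have "range (e(i := a)) \<subseteq> univ N" if "range e \<subseteq> univ N" "a \<in> univ N"
    for e :: "nat \<Rightarrow> 'a" and a
    using that by auto
  with R show "true_in N (Forall i \<phi>)"
    unfolding true_in_def by auto
qed

lemma true_in_foldr_All: "true_in N (foldr Forall xs \<phi>) \<longleftrightarrow> true_in N \<phi>"
  by (induction xs) (simp_all add: true_in_All)

lemma finite_vars_tm: "finite (vars_tm t)"
  by (induction t) auto

lemma finite_fv: "finite (fv \<phi>)"
  by (induction \<phi>) (auto simp: finite_vars_tm)

lemma true_in_model_of_Th:
  assumes N: "model_of N (Th K)" and \<phi>: "true_in K \<phi>"
  shows "true_in N \<phi>"
proof -
  obtain xs where xs: "set xs = fv \<phi>"
    using finite_list[OF finite_fv] by blast
  have "fv (foldr Forall xs \<phi>) = fv \<phi> - set xs" for xs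
    by (induction xs) auto
  then have "foldr Forall xs \<phi> \<in> Th K"
    using xs \<phi> by (simp add: Th_def sentence_def true_in_foldr_All)
  then have "true_in N (foldr Forall xs \<phi>)"
    using N by (simp add: model_of_def)
  then show ?thesis by (simp add: true_in_foldr_All)
qed

definition big_conj :: "fm list \<Rightarrow> fm" where
  "big_conj \<phi>s = foldr Conj \<phi>s (Equal Zero Zero)"

lemma sat_big_conj: "sat N e (big_conj \<phi>s) \<longleftrightarrow> (\<forall>\<phi>\<in>set \<phi>s. sat N e \<phi>)"
  unfolding big_conj_def by (induction \<phi>s) auto


section \<open>Realizing partial types\<close>

definition fin_sat :: "'a L_struct \<Rightarrow> (fm \<times> (nat \<Rightarrow> 'a)) set \<Rightarrow> bool" where
  "fin_sat N q \<longleftrightarrow> (\<forall>F. finite F \<and> F \<subseteq> q \<longrightarrow> (\<exists>a. realizes N a F))"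

text \<open>
  Saturation is formulated for complete types only. A finitely satisfiable set extends to a maximal
  one by Zorn's lemma, and a maximal one is complete: if neither \<open>\<phi>\<close> nor its negation could be
  added, two finite sets would witness this, but an element realizing their union satisfies one of
  the two formulas.
\<close>

lemma aleph1_saturated_realizes:
  assumes N: "aleph1_saturated N" and A: "A \<subseteq> univ N" "countable A"
    and q: "q \<subseteq> formulas_over A" "fin_sat N q"
  shows "\<exists>a. realizes N a q"
proof -
  define Z where "Z = {r. q \<subseteq> r \<and> r \<subseteq> formulas_over A \<and> fin_sat N r}"
  have "\<exists>r\<in>Z. \<forall>s\<in>Z. r \<subseteq> s \<longrightarrow> s = r"
  proof (rule subset_Zorn_nonempty)
    show "Z \<noteq> {}" using q by (auto simp: Z_def)
  next
    fix C assume C: "C \<noteq> {}" "subset.chain Z C"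
    have "fin_sat N (\<Union>C)"
      unfolding fin_sat_def
    proof (intro allI impI)
      fix F assume F: "finite F \<and> F \<subseteq> \<Union>C"
      then obtain r where "r \<in> C" "F \<subseteq> r"
        using finite_subset_Union_chain[of F C Z] C by blast
      moreover from \<open>r \<in> C\<close> have "fin_sat N r"
        using C by (auto simp: subset.chain_def Z_def)
      ultimately show "\<exists>a. realizes N a F"
        using F by (auto simp: fin_sat_def)
    qed
    then show "\<Union>C \<in> Z"
      using C unfolding Z_def subset.chain_def by blast
  qed
  then obtain r where r: "r \<in> Z" and max: "\<And>s. s \<in> Z \<Longrightarrow> r \<subseteq> s \<Longrightarrow> s = r"
    by blast
  have refuted: "\<exists>F. finite F \<and> F \<subseteq> r \<and> \<not> (\<exists>a. realizes N a (insert x F))"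
    if x: "x \<in> formulas_over A" "x \<notin> r" for x
  proof -
    have "insert x r \<notin> Z" using max[of "insert x r"] x by auto
    then have "\<not> fin_sat N (insert x r)"
      using r x by (auto simp: Z_def)
    then obtain F where F: "finite F" "F \<subseteq> insert x r" "\<not> (\<exists>a. realizes N a F)"
      by (auto simp: fin_sat_def)
    have "\<not> (\<exists>a. realizes N a (insert x (F - {x})))"
      using F(3) by (auto simp: realizes_def)
    with F show ?thesis
      by (intro exI[of _ "F - {x}"]) auto
  qed
  have "(\<phi>, e) \<in> r \<or> (Neg \<phi>, e) \<in> r" if \<phi>: "(\<phi>, e) \<in> formulas_over A" for \<phi> e
  proof (rule ccontr)
    assume "\<not> ?thesis"
    moreover have "(Neg \<phi>, e) \<in> formulas_over A"
      using \<phi> by (simp add: formulas_over_def)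
    ultimately obtain F F' where
      F: "finite F" "F \<subseteq> r" "\<not> (\<exists>a. realizes N a (insert (\<phi>, e) F))" and
      F': "finite F'" "F' \<subseteq> r" "\<not> (\<exists>a. realizes N a (insert (Neg \<phi>, e) F'))"
      using refuted[of "(\<phi>, e)"] refuted[of "(Neg \<phi>, e)"] \<phi> by auto
    have "finite (F \<union> F') \<and> F \<union> F' \<subseteq> r" using F F' by blast
    then obtain a where "realizes N a (F \<union> F')"
      using r unfolding Z_def fin_sat_def by blast
    then have "realizes N a (insert (\<phi>, e) F) \<or> realizes N a (insert (Neg \<phi>, e) F')"
      by (auto simp: realizes_def)
    with F(3) F'(3) show False by blast
  qed
  then have "complete_type N A r"
    using r by (auto simp: complete_type_def Z_def fin_sat_def)
  then obtain a where "realizes N a r"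
    using N A unfolding aleph1_saturated_def by blast
  moreover have "q \<subseteq> r" using r by (simp add: Z_def)
  ultimately show ?thesis
    unfolding realizes_def by blast
qed

text \<open>
  For finite \<open>\<Phi>\<^sub>0 \<subseteq> \<Phi>\<close>, the formula \<open>\<theta> \<longrightarrow> (\<exists>x. \<And>\<Phi>\<^sub>0)\<close> is true in \<open>K\<close> and therefore in \<open>N\<close>. The
  set \<open>\<Phi>\<close> is then realized in \<open>N\<close> by saturation over the range of the assignment, which is
  countable because there are only countably many variables.
\<close>

lemma realizable_transfer:
  fixes N :: "'a L_struct" and K :: "'b L_struct"
  assumes N: "model_of N (Th K)" "aleph1_saturated N"
    and K: "\<And>e. range e \<subseteq> univ K \<Longrightarrow> sat K e \<theta> \<Longrightarrow>
               \<exists>a\<in>univ K. \<forall>\<phi>\<in>\<Phi>. sat K (e(0 := a)) \<phi>"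
    and e: "range e \<subseteq> univ N" "sat N e \<theta>"
  shows "\<exists>a\<in>univ N. \<forall>\<phi>\<in>\<Phi>. sat N (e(0 := a)) \<phi>"
proof -
  let ?q = "(\<lambda>\<phi>. (\<phi>, e)) ` \<Phi>"
  have "fin_sat N ?q"
    unfolding fin_sat_def
  proof (intro allI impI)
    fix F assume "finite F \<and> F \<subseteq> ?q"
    then obtain \<Phi>0 where \<Phi>0: "\<Phi>0 \<subseteq> \<Phi>" "finite \<Phi>0" "F = (\<lambda>\<phi>. (\<phi>, e)) ` \<Phi>0"
      by (meson finite_subset_image)
    obtain \<phi>s where \<phi>s: "set \<phi>s = \<Phi>0"
      using finite_list[OF \<Phi>0(2)] by blast
    let ?\<psi> = "Neg (Conj \<theta> (Neg (Ex 0 (big_conj \<phi>s))))"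
    have "true_in K ?\<psi>"
      unfolding true_in_def
    proof (intro allI impI)
      fix d :: "nat \<Rightarrow> 'b" assume "range d \<subseteq> univ K"
      then show "sat K d ?\<psi>"
        using K[of d] \<Phi>0(1) unfolding sat.simps sat_big_conj \<phi>s by blast
    qed
    then have "true_in N ?\<psi>"
      using N(1) by (rule true_in_model_of_Th[rotated])
    then have "sat N e ?\<psi>" using e(1) by (auto simp: true_in_def)
    then obtain a where "a \<in> univ N" "\<forall>\<phi>\<in>\<Phi>0. sat N (e(0 := a)) \<phi>"
      using e(2) \<phi>s by (auto simp: sat_big_conj)
    then show "\<exists>a. realizes N a F"
      using \<Phi>0(3) by (auto simp: realizes_def)
  qed
  moreover have "?q \<subseteq> formulas_over (range e)"
    by (auto simp: formulas_over_def)
  moreover have "countable (range e)" by simp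
  ultimately obtain a where "realizes N a ?q"
    using aleph1_saturated_realizes[OF N(2) e(1)] by blast
  then show ?thesis by (auto simp: realizes_def)
qed


section \<open>Separation in \<open>M\<close>\<close>

text \<open>
  The level \<open>card A\<close> is the only one at which the indicator function of \<open>A\<close> belongs to \<open>G\<^sub>n\<close>; at
  every other level the zero vector satisfies all relations.
\<close>

lemma separating_vector:
  assumes "finite A" "b \<notin> A"
  shows "\<exists>\<eta>\<in>G_omega. (\<forall>n. \<forall>a\<in>A. \<eta> \<in> H n a) \<and> \<eta> \<notin> H (card A) b"
proof -
  obtain u where u: "fset u = A"
    using Abs_fset_inverse[of A] assms(1) by blast
  then have cu: "fcard u = card A" by (simp add: fcard.rep_eq)
  define \<eta> :: "nat \<Rightarrow> V" where
    "\<eta> = (\<lambda>n. if n = card A then Poly_Mapping.single u 1 else 0)"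
  have "\<eta> \<in> G_omega" by (simp add: G_omega_def G_def \<eta>_def cu)
  moreover have "\<eta> \<in> H n a" if "a \<in> A" for n a
    using \<open>\<eta> \<in> G_omega\<close> that cu u by (auto simp: H_def G2_def \<eta>_def)
  moreover have "\<eta> \<notin> H (card A) b"
    using u assms(2) by (auto simp: H_def G2_def \<eta>_def)
  ultimately show ?thesis by blast
qed

text \<open>
  The elements of \<open>W\<close> and \<open>j\<close> are (indices of) variables naming the parameters. They are meant to
  be positive, variable \<open>0\<close> being reserved for the realization.
\<close>

definition separating_type :: "nat set \<Rightarrow> nat \<Rightarrow> fm set" where
  "separating_type W j =
     {FP (Var 0), Neg (FR (card W) (Var 0) (Var j))} \<union> {FR n (Var 0) (Var i) | n i. i \<in> W}"

definition distinct_Q :: "nat list \<Rightarrow> fm" where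
  "distinct_Q xs = big_conj
     (map (\<lambda>i. FQ (Var i)) xs @
      [Neg (Equal (Var i) (Var k)). i \<leftarrow> xs, k \<leftarrow> xs, i \<noteq> k])"

lemma sat_distinct_Q:
  "sat N e (distinct_Q xs) \<longleftrightarrow> e ` set xs \<subseteq> QI N \<and> inj_on e (set xs)"
proof -
  have set_pairs: "set [Neg (Equal (Var i) (Var k)). i \<leftarrow> xs, k \<leftarrow> xs, i \<noteq> k] =
      {Neg (Equal (Var i) (Var k)) | i k. i \<in> set xs \<and> k \<in> set xs \<and> i \<noteq> k}"
    by auto
  have "sat N e (distinct_Q xs) \<longleftrightarrow>
      (\<forall>i\<in>set xs. e i \<in> QI N) \<and> (\<forall>i\<in>set xs. \<forall>k\<in>set xs. i \<noteq> k \<longrightarrow> e i \<noteq> e k)"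
    unfolding distinct_Q_def sat_big_conj set_append ball_Un set_pairs by fastforce
  then show ?thesis by (auto simp: inj_on_def)
qed

lemma separating_type_realized_in_M:
  assumes xs: "set xs = insert j W" "j \<notin> W" "0 \<notin> insert j W"
    and e: "sat M e (distinct_Q xs)"
  shows "\<exists>a\<in>univ M. \<forall>\<phi>\<in>separating_type W j. sat M (e(0 := a)) \<phi>"
proof -
  have inj: "inj_on e (insert j W)" and Q: "\<forall>i\<in>insert j W. e i \<in> range Inr"
    using e xs by (auto simp: sat_distinct_Q M_def)
  define c where "c = (\<lambda>i. projr (e i))"
  have c: "e i = Inr (c i)" if "i \<in> insert j W" for i
    using Q that unfolding c_def by (metis imageE sum.sel(2))
  have injc: "inj_on c (insert j W)"
    using inj c by (metis inj_on_def)
  have "finite W" using xs(1) by (metis List.finite_set finite_insert)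
  moreover have "c j \<notin> c ` W" using injc xs(2) by (auto simp: inj_on_def)
  moreover have "card (c ` W) = card W"
    using injc by (auto intro: card_image inj_on_subset)
  ultimately obtain \<eta> where \<eta>: "\<eta> \<in> G_omega" "\<forall>n. \<forall>i\<in>W. \<eta> \<in> H n (c i)" "\<eta> \<notin> H (card W) (c j)"
    using separating_vector[of "c ` W" "c j"] by auto
  have nz: "j \<noteq> 0 \<and> (\<forall>i\<in>W. i \<noteq> 0)" using xs(3) by (metis insertCI)
  show ?thesis
  proof (intro bexI ballI)
    show "Inl \<eta> \<in> univ M" using \<eta> by (simp add: M_def)
    fix \<phi> assume "\<phi> \<in> separating_type W j"
    then show "sat M (e(0 := Inl \<eta>)) \<phi>"
      using \<eta> nz c by (auto simp: separating_type_def M_def)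
  qed
qed


section \<open>Separation in saturated models\<close>

lemma mem_p_set_iff:
  "x \<in> p_set N a \<longleftrightarrow> x \<in> univ N \<and> (\<forall>n. (x, a) \<in> RI N n)"
  by (auto simp: p_set_def p_def)

theorem claim4p1:
  fixes N :: "'a L_struct" and m :: nat and \<alpha> :: "nat \<Rightarrow> 'a"
  assumes "model_of N (Th M)"
    and "aleph1_saturated N"
    and "\<forall>i\<le>m. \<alpha> i \<in> QI N"
    and "inj_on \<alpha> {..m}"
  shows "\<forall>v. v \<subseteq> {..m} \<and> card v = m \<longrightarrow> p_Inter N \<alpha> {..m} \<noteq> p_Inter N \<alpha> v"
proof (intro allI impI)
  fix v assume v: "v \<subseteq> {..m} \<and> card v = m"
  then have "v \<noteq> {..m}" by (metis card_atMost n_not_Suc_n)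
  with v obtain j where j: "j \<le> m" "j \<notin> v" by blast
  let ?W = "Suc ` v"
  have "finite v" using v finite_subset by blast
  then obtain xs where xs: "set xs = insert (Suc j) ?W"
    by (metis finite_imageI finite_insert finite_list)
  \<comment> \<open>The truncation by \<open>min\<close> only serves to keep all values of the assignment in the universe.\<close>
  define e where "e = (\<lambda>k. \<alpha> (min (k - 1) m))"
  have e_Suc: "e (Suc i) = \<alpha> i" if "i \<le> m" for i
    using that by (simp add: e_def)
  have "QI N \<subseteq> univ N"
    using assms(1) by (simp add: model_of_def L_structure_def)
  then have range_e: "range e \<subseteq> univ N" using assms(3) by (auto simp: e_def)
  have "set xs = Suc ` insert j v" "insert j v \<subseteq> {..m}" using xs v j by auto
  moreover from this(2) have "inj_on (e \<circ> Suc) (insert j v)"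
    using assms(4) e_Suc by (auto simp: inj_on_def subset_iff)
  ultimately have "sat N e (distinct_Q xs)"
    using assms(3) e_Suc by (auto simp: sat_distinct_Q inj_on_imageI)
  then obtain a where a: "a \<in> univ N" "\<forall>\<phi>\<in>separating_type ?W (Suc j). sat N (e(0 := a)) \<phi>"
    using realizable_transfer[OF assms(1,2) separating_type_realized_in_M[OF xs] range_e] j(2)
    by blast
  have "a \<in> PI N" "(a, \<alpha> j) \<notin> RI N (card ?W)"
    using a(2) e_Suc j(1) by (auto simp: separating_type_def)
  moreover have "a \<in> p_set N (\<alpha> i)" if "i \<in> v" for i
    unfolding mem_p_set_iff
  proof (intro conjI allI)
    fix n
    have "FR n (Var 0) (Var (Suc i)) \<in> separating_type ?W (Suc j)"
      using that by (auto simp: separating_type_def)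
    then have "(a, e (Suc i)) \<in> RI N n" using a(2) by fastforce
    then show "(a, \<alpha> i) \<in> RI N n" using e_Suc v that by auto
  qed (rule a(1))
  ultimately have "a \<in> p_Inter N \<alpha> v" "a \<notin> p_Inter N \<alpha> {..m}"
    using j(1) by (auto simp: p_Inter_def mem_p_set_iff)
  then show "p_Inter N \<alpha> {..m} \<noteq> p_Inter N \<alpha> v" by blast
qed

end
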